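(* If $G$ is a finitely generated solvable group satisfying max-n, then $G$ has a finite generating set $B$ such that $\mathrm{PW}(G,B)$ is finite.
   Context: A group $G$ satisfies the maximal condition for normal subgroups (max-n) if for every normal subgroup $N$ of $G$ there is a finite subset whose normal closure in $G$ is $N$. For a group $G$ with generating set $X$, a palindromic word on $X \cup X^{-1}$ is a finite word with letters in $X\cup X^{-1}$ (not necessarily reduced) that reads the same forwards as backwards. The palindromic width $\mathrm{PW}(G,X)$ is the minimal $n$ such that every $g\in G$ can be expressed as a product of $n$ or fewer elements represented by palindromic words on $X\cup X^{-1}$ (and is infinite if no such $n$ exists). *)

theory Defs
  imports "HOL-Algebra.Solvable_Groups" "HOL-Library.Extended_Nat"
begin

definition generating_set :: "('a, 'b) monoid_scheme \<Rightarrow> 'a set \<Rightarrow> bool" where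
  "generating_set G X \<longleftrightarrow> X \<subseteq> carrier G \<and> generate G X = carrier G"

definition finitely_generated :: "('a, 'b) monoid_scheme \<Rightarrow> bool" where
  "finitely_generated G \<longleftrightarrow> (\<exists>X. finite X \<and> generating_set G X)"

definition normal_closure :: "('a, 'b) monoid_scheme \<Rightarrow> 'a set \<Rightarrow> 'a set" where
  "normal_closure G S = \<Inter> {N. N \<lhd> G \<and> S \<subseteq> N}"

definition max_n :: "('a, 'b) monoid_scheme \<Rightarrow> bool" where
  "max_n G \<longleftrightarrow>
     (\<forall>N. N \<lhd> G \<longrightarrow> (\<exists>S. finite S \<and> S \<subseteq> carrier G \<and> normal_closure G S = N))"

definition list_mult :: "('a, 'b) monoid_scheme \<Rightarrow> 'a list \<Rightarrow> 'a" where
  "list_mult G xs = foldr (mult G) xs \<one>\<^bsub>G\<^esub>"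

(* The letters are the group elements in X and their inverses.  A word is an arbitrary list of
   letters: it need not be reduced, and the empty word is a palindrome representing the identity. *)
definition palindromic_word :: "('a, 'b) monoid_scheme \<Rightarrow> 'a set \<Rightarrow> 'a list \<Rightarrow> bool" where
  "palindromic_word G X w \<longleftrightarrow> set w \<subseteq> X \<union> m_inv G ` X \<and> rev w = w"

definition palindromic_elements :: "('a, 'b) monoid_scheme \<Rightarrow> 'a set \<Rightarrow> 'a set" where
  "palindromic_elements G X = {list_mult G w | w. palindromic_word G X w}"

(* In enat the infimum of a nonempty set is its minimum and the infimum of the empty set is
   infinity. *)
definition palindromic_width :: "('a, 'b) monoid_scheme \<Rightarrow> 'a set \<Rightarrow> enat" where
  "palindromic_width G X =
     Inf {enat n | n. \<forall>g \<in> carrier G. \<exists>ps. length ps \<le> n \<and>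
                       set ps \<subseteq> palindromic_elements G X \<and> g = list_mult G ps}"

end

(* Descend the derived series, enlarging the finite generating set B at each step.  Modulo the next
   term, the current term A is an abelian normal subgroup, by max-n the normal closure of a finite
   set S; put S into B.  Each b in A is the value of the reversal of a word w with value a in A, so
   for a letter x the commutator
     [x, b] = a [x, b] a^-1 = (a x b) x^-1 (a b)^-1
   is a product of three palindromes.  The finitely many subgroups [x, A] (x in B) and <s> (s in S)
   of A therefore generate a subgroup of products of boundedly many palindromes; it is normal, because it
   contains [x, A] for all generators x, and it contains S, so it is A. *)

theory Submission
  imports Defs
begin

section \<open>Palindromes and their bounded products\<close>

definition palindrome_products :: "('a, 'b) monoid_scheme \<Rightarrow> 'a set \<Rightarrow> nat \<Rightarrow> 'a set" where
  "palindrome_products G X n =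
     {list_mult G ps | ps. length ps \<le> n \<and> set ps \<subseteq> palindromic_elements G X}"

lemma list_mult_simps [simp]:
  "list_mult G [] = \<one>\<^bsub>G\<^esub>"
  "list_mult G (x # xs) = x \<otimes>\<^bsub>G\<^esub> list_mult G xs"
  by (simp_all add: list_mult_def)

lemma palindromic_elements_mono:
  "X \<subseteq> Y \<Longrightarrow> palindromic_elements G X \<subseteq> palindromic_elements G Y"
  unfolding palindromic_elements_def palindromic_word_def by blast

lemma palindrome_products_mono:
  assumes "m \<le> n" "X \<subseteq> Y"
  shows "palindrome_products G X m \<subseteq> palindrome_products G Y n"
  unfolding palindrome_products_def
  using palindromic_elements_mono[OF assms(2), of G] assms(1)
  by (blast intro: order_trans)

lemma normal_closure_minimal:
  assumes "K \<lhd> G" "S \<subseteq> K"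
  shows "normal_closure G S \<subseteq> K"
  unfolding normal_closure_def using assms by blast

lemma subset_normal_closure: "S \<subseteq> normal_closure G S"
  unfolding normal_closure_def by blast

context group
begin

abbreviation letters :: "'a set \<Rightarrow> 'a set" where
  "letters X \<equiv> X \<union> m_inv G ` X"

lemma letters_closed: "X \<subseteq> carrier G \<Longrightarrow> letters X \<subseteq> carrier G"
  by auto

lemma inv_letter:
  assumes "X \<subseteq> carrier G" "x \<in> letters X"
  shows "inv x \<in> letters X"
  using assms by (auto simp: subset_iff)

lemma list_mult_closed [simp]: "set w \<subseteq> carrier G \<Longrightarrow> list_mult G w \<in> carrier G"
  by (induction w) auto

lemma list_mult_append [simp]:
  "set u \<subseteq> carrier G \<Longrightarrow> set v \<subseteq> carrier G \<Longrightarrow>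
     list_mult G (u @ v) = list_mult G u \<otimes> list_mult G v"
  by (induction u) (auto simp: m_assoc)

text \<open>Inverting a product also reverses the order of its factors, so inverting the letters in
  place gives the inverse of the reversed word.\<close>

lemma list_mult_map_inv:
  "set w \<subseteq> carrier G \<Longrightarrow> list_mult G (map (m_inv G) w) = inv (list_mult G (rev w))"
proof (induction w)
  case (Cons a w)
  then have "set (rev w) \<subseteq> carrier G" "a \<in> carrier G" by auto
  with Cons show ?case by (simp add: inv_mult_group)
qed simp

lemma list_mult_replicate:
  "x \<in> carrier G \<Longrightarrow> list_mult G (replicate n x) = x [^] n"
  by (induction n) (simp_all add: nat_pow_Suc2[symmetric] del: nat_pow_Suc)

lemma map_inv_letters:
  assumes "X \<subseteq> carrier G" "set w \<subseteq> letters X"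
  shows "set (map (m_inv G) w) \<subseteq> letters X"
  using assms(2) inv_letter[OF assms(1)] by (induction w) auto

lemma generate_eq_words:
  assumes "X \<subseteq> carrier G" "g \<in> generate G X"
  shows "\<exists>w. set w \<subseteq> letters X \<and> g = list_mult G w"
  using assms(2)
proof (induction g rule: generate.induct)
  case one
  show ?case by (intro exI[of _ "[]"]) simp
next
  case (incl h)
  then show ?case using assms(1) by (intro exI[of _ "[h]"]) auto
next
  case (inv h)
  then show ?case using assms(1) by (intro exI[of _ "[inv h]"]) auto
next
  case (eng h1 h2)
  then obtain u v where uv: "set u \<subseteq> letters X" "h1 = list_mult G u"
    "set v \<subseteq> letters X" "h2 = list_mult G v" by blast
  then have "set u \<subseteq> carrier G" "set v \<subseteq> carrier G"
    using letters_closed[OF assms(1)] by blast+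
  with uv show ?case by (intro exI[of _ "u @ v"]) simp
qed

lemma palindromic_elementI:
  "set w \<subseteq> letters X \<Longrightarrow> rev w = w \<Longrightarrow> list_mult G w \<in> palindromic_elements G X"
  unfolding palindromic_elements_def palindromic_word_def by blast

lemma palindromic_elements_closed:
  assumes "X \<subseteq> carrier G"
  shows "palindromic_elements G X \<subseteq> carrier G"
  unfolding palindromic_elements_def palindromic_word_def
  using letters_closed[OF assms] list_mult_closed by blast

text \<open>Inverting letters in place preserves the palindromic shape, and for a palindrome the
  reversal in \<open>list_mult_map_inv\<close> disappears.\<close>

lemma palindromic_elements_inv:
  assumes "X \<subseteq> carrier G" "p \<in> palindromic_elements G X"
  shows "inv p \<in> palindromic_elements G X"
proof -
  obtain w where w: "p = list_mult G w" "set w \<subseteq> letters X" "rev w = w"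
    using assms(2) unfolding palindromic_elements_def palindromic_word_def by blast
  have "inv p = list_mult G (map (m_inv G) w)"
    using list_mult_map_inv[of w] w(1,3) subset_trans[OF w(2) letters_closed[OF assms(1)]] by simp
  moreover have "rev (map (m_inv G) w) = map (m_inv G) w"
    using w(3) by (simp add: rev_map)
  ultimately show ?thesis
    using palindromic_elementI[OF map_inv_letters[OF assms(1) w(2)]] by metis
qed

lemma palindrome_products_closed:
  assumes "X \<subseteq> carrier G"
  shows "palindrome_products G X n \<subseteq> carrier G"
  unfolding palindrome_products_def
  using palindromic_elements_closed[OF assms] list_mult_closed by blast

lemma palindrome_products_one: "\<one> \<in> palindrome_products G X n"
  unfolding palindrome_products_def by (auto intro!: exI[of _ "[]"])

lemma palindrome_products_single:
  assumes "X \<subseteq> carrier G" "p \<in> palindromic_elements G X"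
  shows "p \<in> palindrome_products G X 1"
  unfolding palindrome_products_def
  using assms palindromic_elements_closed[OF assms(1)] by (auto intro!: exI[of _ "[p]"])

lemma palindrome_products_mult:
  assumes "X \<subseteq> carrier G" "a \<in> palindrome_products G X m" "b \<in> palindrome_products G X n"
  shows "a \<otimes> b \<in> palindrome_products G X (m + n)"
proof -
  obtain us vs where "a = list_mult G us" "length us \<le> m" "set us \<subseteq> palindromic_elements G X"
    "b = list_mult G vs" "length vs \<le> n" "set vs \<subseteq> palindromic_elements G X"
    using assms unfolding palindrome_products_def by blast
  with palindromic_elements_closed[OF assms(1)] show ?thesis
    unfolding palindrome_products_def by (auto intro!: exI[of _ "us @ vs"])
qed

text \<open>A power of a letter is spelled by a constant word, and a constant word is a palindrome.
  Hence a whole cyclic subgroup generated by a letter costs only one palindrome.\<close>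

lemma int_pow_palindromic:
  assumes "x \<in> X" "X \<subseteq> carrier G"
  shows "x [^] (k :: int) \<in> palindromic_elements G X"
proof -
  have x: "x \<in> carrier G" using assms by blast
  have *: "x [^] (n :: nat) \<in> palindromic_elements G X" for n
    using palindromic_elementI[of "replicate n x" X] assms(1) x
    by (auto simp: list_mult_replicate set_replicate_conv_if split: if_splits)
  show ?thesis
  proof (cases k)
    case (nonneg n)
    then show ?thesis using * by (simp add: int_pow_int)
  next
    case (neg n)
    then show ?thesis
      using palindromic_elements_inv[OF assms(2) *] x by (simp only: int_pow_neg int_pow_int)
  qed
qed

section \<open>Commutators and bounded generation in abelian normal subgroups\<close>

text \<open>Together with \<open>m_assoc\<close> these rules cancel neighbouring inverse pairs
  inside right-nested products, which settles the commutator identities below by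
  simplification.\<close>

lemma inv_mult_cancel_left [simp]:
  "x \<in> carrier G \<Longrightarrow> y \<in> carrier G \<Longrightarrow> inv x \<otimes> (x \<otimes> y) = y"
  "x \<in> carrier G \<Longrightarrow> y \<in> carrier G \<Longrightarrow> x \<otimes> (inv x \<otimes> y) = y"
  by (simp_all add: m_assoc[symmetric])

text \<open>If a word and its reversal both evaluate into \<open>A\<close>, so do \<open>u w u'\<close> and its reversal, where
  \<open>u'\<close> is the formal inverse of \<open>u\<close>: the reversal is conjugated by the word \<open>u'\<close> reversed.
  Hence the values of such words form a normal subgroup.\<close>
lemma normal_closure_reversible_word:
  assumes A: "A \<lhd> G" and X: "X \<subseteq> carrier G" "generate G X = carrier G"
    and S: "S \<subseteq> X \<inter> A" "A \<subseteq> normal_closure G S" and b: "b \<in> A"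
  shows "\<exists>w. set w \<subseteq> letters X \<and> list_mult G w \<in> A \<and> list_mult G (rev w) = b"
proof -
  interpret A: normal A G by fact
  define T where "T = {list_mult G (rev w) | w. set w \<subseteq> letters X \<and>
    list_mult G w \<in> A \<and> list_mult G (rev w) \<in> A}"
  have L: "set w \<subseteq> carrier G" if "set w \<subseteq> letters X" for w
    using that letters_closed[OF X(1)] by blast
  have "T \<lhd> G"
  proof (rule normal_invI)
    show "subgroup T G"
    proof (rule subgroupI)
      show "T \<subseteq> carrier G" unfolding T_def using A.subset by blast
      have "\<one> \<in> T" unfolding T_def by (auto intro!: exI[of _ "[]"])
      then show "T \<noteq> {}" by blast
      fix a assume "a \<in> T"
      then obtain u where u: "set u \<subseteq> letters X" "list_mult G u \<in> A"
        "list_mult G (rev u) \<in> A" "a = list_mult G (rev u)" unfolding T_def by blast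
      define u' where "u' = map (m_inv G) (rev u)"
      have "set u' \<subseteq> letters X"
        unfolding u'_def using map_inv_letters[OF X(1), of "rev u"] u(1) by simp
      moreover have "list_mult G u' = inv (list_mult G u)"
        unfolding u'_def using list_mult_map_inv[of "rev u"] L[OF u(1)] by simp
      moreover have "list_mult G (rev u') = inv a"
        unfolding u'_def u(4) using list_mult_map_inv[of u] L[OF u(1)] by (simp add: rev_map)
      ultimately show "inv a \<in> T" unfolding T_def using u by (auto intro!: exI[of _ u'])
      fix b assume "b \<in> T"
      then obtain v where v: "set v \<subseteq> letters X" "list_mult G v \<in> A"
        "list_mult G (rev v) \<in> A" "b = list_mult G (rev v)" unfolding T_def by blast
      \<comment> \<open>The order is \<open>v @ u\<close> because reversal swaps the two blocks and
        the reversed word must evaluate to \<open>a \<otimes> b\<close>.\<close>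
      have "list_mult G (v @ u) = list_mult G v \<otimes> list_mult G u"
        "list_mult G (rev (v @ u)) = a \<otimes> b"
        using L[OF u(1)] L[OF v(1)] u v by simp_all
      then show "a \<otimes> b \<in> T" unfolding T_def using u v
        by (intro CollectI exI[of _ "v @ u"]) auto
    qed
  next
    fix g a assume g: "g \<in> carrier G" and "a \<in> T"
    then obtain u where u: "set u \<subseteq> letters X" "list_mult G u \<in> A"
      "list_mult G (rev u) \<in> A" "a = list_mult G (rev u)" unfolding T_def by blast
    obtain v where v: "set v \<subseteq> letters X" "g = list_mult G v"
      using generate_eq_words[OF X(1)] g X(2) by blast
    define v' where "v' = map (m_inv G) v"
    have v': "set v' \<subseteq> letters X" unfolding v'_def using map_inv_letters[OF X(1) v(1)] .
    have 1: "list_mult G v' = inv (list_mult G (rev v))"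
      unfolding v'_def using list_mult_map_inv L[OF v(1)] by blast
    have 2: "list_mult G (rev v') = inv g"
      unfolding v'_def v(2) using list_mult_map_inv[of "rev v"] L[OF v(1)] by (simp add: rev_map)
    \<comment> \<open>Reversed, this word reads \<open>v\<close>, \<open>rev u\<close>,
      \<open>rev v'\<close> and evaluates to the desired conjugate by \<open>g\<close>. Read
      forwards it is a conjugate by a different element, the value of \<open>rev v\<close>, but
      normality of \<open>A\<close> still keeps it in \<open>A\<close>.\<close>
    define w where "w = v' @ u @ rev v"
    have w: "set w \<subseteq> letters X" unfolding w_def using u v v' by auto
    have "list_mult G w = inv (list_mult G (rev v)) \<otimes> list_mult G u \<otimes> list_mult G (rev v)"
      unfolding w_def using L[OF u(1)] L[OF v(1)] L[OF v'] 1 by (simp add: m_assoc)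
    then have "list_mult G w \<in> A" using A.inv_op_closed1[OF _ u(2)] L[OF v(1)] by simp
    moreover have "list_mult G (rev w) = g \<otimes> a \<otimes> inv g"
      unfolding w_def using L[OF u(1)] L[OF v(1)] L[OF v'] 2 u(4) v(2) by (simp add: m_assoc)
    ultimately show "g \<otimes> a \<otimes> inv g \<in> T"
      unfolding T_def using w A.inv_op_closed2[OF g] u(3,4) by (auto intro!: exI[of _ w])
  qed
  moreover have "S \<subseteq> T"
  proof
    fix s assume "s \<in> S"
    then show "s \<in> T"
      \<comment> \<open>A one-letter word equals its own reversal. This is where it matters that the
        elements of \<open>S\<close> are letters.\<close>
      unfolding T_def using S(1) X(1) by (intro CollectI exI[of _ "[s]"]) auto
  qed
  ultimately have "b \<in> T" using normal_closure_minimal S(2) b by blast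
  then show ?thesis unfolding T_def by blast
qed

text \<open>Any element \<open>a\<close> of \<open>A\<close> may be conjugated into the commutator
  without changing it, as the commutator lies in the abelian subgroup \<open>A\<close>. Taking for
  \<open>a\<close> the value of a word whose reversal spells \<open>b\<close> makes
  \<open>a x b\<close> and \<open>a b\<close> palindromes.\<close>

lemma commutator_palindrome_product:
  assumes A: "A \<lhd> G" and comm: "\<And>a b. a \<in> A \<Longrightarrow> b \<in> A \<Longrightarrow> a \<otimes> b = b \<otimes> a"
    and X: "X \<subseteq> carrier G" "generate G X = carrier G"
    and S: "S \<subseteq> X \<inter> A" "A \<subseteq> normal_closure G S" and b: "b \<in> A" and x: "x \<in> X"
  shows "x \<otimes> b \<otimes> inv x \<otimes> inv b \<in> palindrome_products G X 3"
proof -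
  interpret A: normal A G by fact
  obtain w where w: "set w \<subseteq> letters X" "list_mult G w \<in> A" "list_mult G (rev w) = b"
    using normal_closure_reversible_word[OF A X S b] by blast
  define a where "a = list_mult G w"
  have c: "a \<in> carrier G" "b \<in> carrier G" "x \<in> carrier G" "set w \<subseteq> carrier G"
    using w b x X letters_closed[OF X(1)] unfolding a_def by auto
  have "list_mult G (w @ [x] @ rev w) \<in> palindromic_elements G X"
    using w x by (intro palindromic_elementI) auto
  then have p1: "a \<otimes> x \<otimes> b \<in> palindromic_elements G X"
    using c w by (simp add: a_def m_assoc)
  have "list_mult G [x] \<in> palindromic_elements G X"
    using x by (intro palindromic_elementI) auto
  then have p2: "inv x \<in> palindromic_elements G X"
    using palindromic_elements_inv[OF X(1)] c by simp
  have "list_mult G (w @ rev w) \<in> palindromic_elements G X"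
    using w by (intro palindromic_elementI) auto
  then have p3: "inv (a \<otimes> b) \<in> palindromic_elements G X"
    using palindromic_elements_inv[OF X(1)] c w by (simp add: a_def)
  define d where "d = x \<otimes> b \<otimes> inv x \<otimes> inv b"
  have d: "d \<in> A"
    unfolding d_def using A.inv_op_closed2[OF c(3) b] b by simp
  have "list_mult G [a \<otimes> x \<otimes> b, inv x, inv (a \<otimes> b)] = a \<otimes> d \<otimes> inv a"
    unfolding d_def using c by (simp add: m_assoc inv_mult_group)
  also have "\<dots> = d"
    using comm[OF _ d, of a] w(2) A.mem_carrier[OF d] c(1) by (simp add: a_def m_assoc)
  finally show ?thesis
    unfolding palindrome_products_def d_def[symmetric] using p1 p2 p3
    by (intro CollectI exI[of _ "[a \<otimes> x \<otimes> b, inv x, inv (a \<otimes> b)]"]) simp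
qed

text \<open>Since everything takes place inside the commutative \<open>A\<close>, the product set of
  two subgroups is again a subgroup. Each further index therefore raises the number of palindromes
  only by \<open>n\<close>.\<close>

lemma commuting_subgroups_bounded:
  assumes A: "subgroup A G" and comm: "\<And>a b. a \<in> A \<Longrightarrow> b \<in> A \<Longrightarrow> a \<otimes> b = b \<otimes> a"
    and X: "X \<subseteq> carrier G" and "finite I"
    and H: "\<And>i. i \<in> I \<Longrightarrow> subgroup (H i) G \<and> H i \<subseteq> A \<and> H i \<subseteq> palindrome_products G X n"
  shows "\<exists>K m. subgroup K G \<and> K \<subseteq> A \<and> K \<subseteq> palindrome_products G X m \<and> (\<Union>i\<in>I. H i) \<subseteq> K"
  using \<open>finite I\<close> H
proof (induction I rule: finite_induct)
  case empty
  have "{\<one>} \<subseteq> palindrome_products G X 0" using palindrome_products_one by blast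
  then show ?case using triv_subgroup subgroup.one_closed[OF A]
    by (intro exI[of _ "{\<one>}"] exI[of _ 0]) simp
next
  case (insert i I)
  then obtain K m where K: "subgroup K G" "K \<subseteq> A" "K \<subseteq> palindrome_products G X m"
    "(\<Union>i\<in>I. H i) \<subseteq> K" by blast
  have Hi: "subgroup (H i) G" "H i \<subseteq> A" "H i \<subseteq> palindrome_products G X n"
    using insert.prems by blast+
  interpret A: subgroup A G by fact
  interpret K: subgroup K G by fact
  interpret Hi: subgroup "H i" G by fact
  define P where "P = {h \<otimes> k | h k. h \<in> H i \<and> k \<in> K}"
  have "subgroup P G"
  proof (rule subgroupI)
    show "P \<subseteq> carrier G" unfolding P_def by auto
    show "P \<noteq> {}" unfolding P_def using Hi.one_closed K.one_closed by blast
    fix p assume "p \<in> P"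
    then obtain h k where p: "h \<in> H i" "k \<in> K" "p = h \<otimes> k" unfolding P_def by blast
    have "k \<otimes> h = h \<otimes> k"
      by (rule comm[OF subsetD[OF K(2) p(2)] subsetD[OF Hi(2) p(1)]])
    then have "inv p = inv h \<otimes> inv k"
      using p K.mem_carrier Hi.mem_carrier by (metis inv_mult_group)
    then show "inv p \<in> P" unfolding P_def using p by blast
    fix q assume "q \<in> P"
    then obtain h' k' where q: "q = h' \<otimes> k'" "h' \<in> H i" "k' \<in> K"
      unfolding P_def by blast
    have *: "k \<otimes> h' = h' \<otimes> k"
      by (rule comm[OF subsetD[OF K(2) p(2)] subsetD[OF Hi(2) q(2)]])
    have "p \<otimes> q = h \<otimes> (k \<otimes> h') \<otimes> k'" using p q by (simp add: m_assoc)
    also have "\<dots> = (h \<otimes> h') \<otimes> (k \<otimes> k')" unfolding * using p q by (simp add: m_assoc)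
    finally show "p \<otimes> q \<in> P" unfolding P_def using p q by blast
  qed
  moreover have "P \<subseteq> A" unfolding P_def using K(2) Hi(2) A.m_closed by blast
  moreover have "P \<subseteq> palindrome_products G X (n + m)"
    unfolding P_def
    using palindrome_products_mult[OF X subsetD[OF Hi(3)] subsetD[OF K(3)]] by blast
  moreover have "(\<Union>j\<in>insert i I. H j) \<subseteq> P"
  proof -
    have P: "a \<otimes> b \<in> P" if "a \<in> H i" "b \<in> K" for a b
      unfolding P_def using that by blast
    have "H i \<subseteq> P"
    proof
      fix a assume a: "a \<in> H i"
      show "a \<in> P" using P[OF a K.one_closed] r_one[OF Hi.mem_carrier[OF a]] by metis
    qed
    moreover have "K \<subseteq> P"
    proof
      fix b assume b: "b \<in> K"
      show "b \<in> P" using P[OF Hi.one_closed b] l_one[OF K.mem_carrier[OF b]] by metis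
    qed
    ultimately show ?thesis using K(4) by (metis SUP_insert Un_least subset_trans)
  qed
  ultimately show ?case by blast
qed

text \<open>For abelian normal \<open>A\<close> the map sending \<open>b\<close> to [x, b] is a
  homomorphism on \<open>A\<close>, so its image is a subgroup: products of such commutators are
  again single commutators.\<close>

lemma commutators_subgroup:
  assumes A: "A \<lhd> G" and comm: "\<And>a b. a \<in> A \<Longrightarrow> b \<in> A \<Longrightarrow> a \<otimes> b = b \<otimes> a"
    and x: "x \<in> carrier G"
  shows "subgroup ((\<lambda>b. x \<otimes> b \<otimes> inv x \<otimes> inv b) ` A) G"
proof -
  interpret A: normal A G by fact
  let ?f = "\<lambda>b. x \<otimes> b \<otimes> inv x \<otimes> inv b"
  have "group_hom (G\<lparr>carrier := A\<rparr>) G ?f"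
  proof (rule group_hom.intro[OF A.subgroup_is_group[OF is_group] is_group group_hom_axioms.intro])
    show "?f \<in> hom (G\<lparr>carrier := A\<rparr>) G"
    proof (rule homI)
      fix a assume "a \<in> carrier (G\<lparr>carrier := A\<rparr>)"
      then show "?f a \<in> carrier G" using x by simp
    next
      fix a b assume "a \<in> carrier (G\<lparr>carrier := A\<rparr>)" "b \<in> carrier (G\<lparr>carrier := A\<rparr>)"
      then have ab: "a \<in> A" "b \<in> A" by simp_all
      define d where "d = x \<otimes> b \<otimes> inv x \<otimes> inv b"
      have d: "d \<in> A" unfolding d_def using A.inv_op_closed2[OF x] ab by simp
      \<comment> \<open>The commutator \<open>d\<close> of \<open>x\<close> and \<open>b\<close>
        sits between the conjugate of \<open>a\<close> and \<open>inv a\<close>. Being in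
        \<open>A\<close>, it can be moved past \<open>inv a\<close>.\<close>
      have "?f (a \<otimes> b) = x \<otimes> a \<otimes> inv x \<otimes> (d \<otimes> inv a)"
        unfolding d_def using x ab by (simp add: m_assoc inv_mult_group)
      also have "d \<otimes> inv a = inv a \<otimes> d" using comm d ab by simp
      finally show "?f (a \<otimes>\<^bsub>G\<lparr>carrier := A\<rparr>\<^esub> b) = ?f a \<otimes> ?f b"
        using x ab A.mem_carrier[OF d] by (simp add: m_assoc d_def)
    qed
  qed
  then show ?thesis using group_hom.img_is_subgroup by fastforce
qed

text \<open>Induction over \<open>generate\<close>, with [h^-1, b] = [h, h^-1 b h]^-1 and [h1 h2, b]
  = [h1, h2 b h2^-1] [h2, b]. The second argument changes, so \<open>b\<close> is generalised;
  normality keeps it in \<open>A\<close>.\<close>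

lemma commutators_in_subgroup:
  assumes A: "A \<lhd> G" and K: "subgroup K G" and X: "X \<subseteq> carrier G"
    and *: "\<And>x b. x \<in> X \<Longrightarrow> b \<in> A \<Longrightarrow> x \<otimes> b \<otimes> inv x \<otimes> inv b \<in> K"
    and g: "g \<in> generate G X" and b: "b \<in> A"
  shows "g \<otimes> b \<otimes> inv g \<otimes> inv b \<in> K"
proof -
  interpret A: normal A G by fact
  interpret K: subgroup K G by fact
  show ?thesis
    using g b
  proof (induction g arbitrary: b rule: generate.induct)
    case (inv h)
    then have h: "h \<in> carrier G" using X by blast
    let ?c = "inv h \<otimes> b \<otimes> h"
    have "h \<otimes> ?c \<otimes> inv h \<otimes> inv ?c \<in> K"
      using * inv(1) A.inv_op_closed1[OF h inv(2)] by blast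
    then have "inv (h \<otimes> ?c \<otimes> inv h \<otimes> inv ?c) \<in> K" by blast
    then show ?case using h A.mem_carrier[OF inv(2)] by (simp add: m_assoc inv_mult_group)
  next
    case (eng h1 h2)
    then have h: "h1 \<in> carrier G" "h2 \<in> carrier G" "b \<in> carrier G"
      using generate_in_carrier[OF X] by auto
    have "h2 \<otimes> b \<otimes> inv h2 \<in> A" using A.inv_op_closed2 h(2) eng.prems by blast
    then have "(h1 \<otimes> (h2 \<otimes> b \<otimes> inv h2) \<otimes> inv h1 \<otimes> inv (h2 \<otimes> b \<otimes> inv h2)) \<otimes>
      (h2 \<otimes> b \<otimes> inv h2 \<otimes> inv b) \<in> K" using eng by blast
    then show ?case using h by (simp add: m_assoc inv_mult_group)
  qed (use * in \<open>auto simp: A.mem_carrier\<close>)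
qed

text \<open>This treats one abelian layer of the derived series; it is applied later in the quotient
  by the next derived subgroup.\<close>

lemma abelian_normal_closure_bounded:
  assumes A: "A \<lhd> G" and comm: "\<And>a b. a \<in> A \<Longrightarrow> b \<in> A \<Longrightarrow> a \<otimes> b = b \<otimes> a"
    and X: "X \<subseteq> carrier G" "generate G X = carrier G" "finite X"
    and S: "S \<subseteq> X \<inter> A" "A \<subseteq> normal_closure G S"
  shows "\<exists>m. A \<subseteq> palindrome_products G X m"
proof -
  interpret A: normal A G by fact
  define H1 where "H1 = (\<lambda>x. (\<lambda>b. x \<otimes> b \<otimes> inv x \<otimes> inv b) ` A)"
  define H2 where "H2 = (\<lambda>s. generate G {s})"
  have H1: "subgroup (H1 x) G \<and> H1 x \<subseteq> A \<and> H1 x \<subseteq> palindrome_products G X 3" if "x \<in> X" for x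
  proof -
    have x: "x \<in> carrier G" using that X by blast
    have "H1 x \<subseteq> palindrome_products G X 3"
      unfolding H1_def using commutator_palindrome_product[OF A comm X(1,2) S _ that] by blast
    moreover have "H1 x \<subseteq> A"
      unfolding H1_def using A.inv_op_closed2[OF x] by auto
    ultimately show ?thesis
      using commutators_subgroup[OF A comm x] unfolding H1_def by blast
  qed
  have H2: "subgroup (H2 s) G \<and> H2 s \<subseteq> A \<and> H2 s \<subseteq> palindrome_products G X 3" if "s \<in> S" for s
  proof -
    have s: "s \<in> carrier G" "s \<in> X" "s \<in> A" using that X S by auto
    \<comment> \<open>One palindrome suffices here; the bound is then relaxed to 3 to share a common
      value with the commutator subgroups.\<close>
    have "H2 s \<subseteq> palindrome_products G X 1"
      unfolding H2_def generate_pow[OF s(1)]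
      using palindrome_products_single[OF X(1)] int_pow_palindromic[OF s(2) X(1)] by blast
    then have "H2 s \<subseteq> palindrome_products G X 3"
      using palindrome_products_mono[of 1 3 X X] by auto
    moreover have "H2 s \<subseteq> A"
      unfolding H2_def using s(3) by (intro generate_subgroup_incl A.subgroup_axioms) auto
    ultimately show ?thesis
      unfolding H2_def using generate_is_subgroup[of "{s}"] s(1) by blast
  qed
  have "finite S" using S(1) X(3) finite_subset by blast
  \<comment> \<open>A disjoint sum serves as index set because \<open>S\<close> lies in
    \<open>X\<close>: an element of \<open>S\<close> contributes both a commutator subgroup and a
    cyclic one.\<close>
  define H where "H = case_sum H1 H2"
  have "\<exists>K m. subgroup K G \<and> K \<subseteq> A \<and> K \<subseteq> palindrome_products G X m \<and>
    (\<Union>i \<in> Inl ` X \<union> Inr ` S. H i) \<subseteq> K"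
  proof (rule commuting_subgroups_bounded[OF A.subgroup_axioms comm X(1), where n = 3])
    show "finite (Inl ` X \<union> Inr ` S)" using X(3) \<open>finite S\<close> by simp
    fix i assume "i \<in> Inl ` X \<union> Inr ` S"
    then show "subgroup (H i) G \<and> H i \<subseteq> A \<and> H i \<subseteq> palindrome_products G X 3"
      using H1 H2 by (elim UnE imageE) (simp_all only: H_def sum.case)
  qed
  then obtain K m where K: "subgroup K G" "K \<subseteq> A" "K \<subseteq> palindrome_products G X m"
    and UK: "(\<Union>i \<in> Inl ` X \<union> Inr ` S. H i) \<subseteq> K" by blast
  have HK: "H1 x \<subseteq> K" if "x \<in> X" for x
    using UK that unfolding H_def by (simp add: SUP_le_iff)
  have HK2: "H2 s \<subseteq> K" if "s \<in> S" for s
    using UK that unfolding H_def by (simp add: SUP_le_iff)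
  interpret K: subgroup K G by fact
  have "K \<lhd> G"
  proof (rule normal_invI[OF K(1)])
    fix g k assume g: "g \<in> carrier G" and k: "k \<in> K"
    \<comment> \<open>A conjugate of \<open>k\<close> is [g, k] times \<open>k\<close>, so normality
      of \<open>K\<close> follows once all commutators with elements of \<open>A\<close> lie in
      \<open>K\<close>.\<close>
    have "g \<otimes> k \<otimes> inv g \<otimes> inv k \<in> K"
      using commutators_in_subgroup[OF A K(1) X(1)] HK g k K(2) X(2)
      unfolding H1_def by blast
    then have "g \<otimes> k \<otimes> inv g \<otimes> inv k \<otimes> k \<in> K" using k by blast
    then show "g \<otimes> k \<otimes> inv g \<in> K" using g K.mem_carrier[OF k] by (simp add: m_assoc)
  qed
  moreover have "S \<subseteq> K"
    using HK2 unfolding H2_def by (blast intro: generate.incl)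
  ultimately have "A \<subseteq> K" using normal_closure_minimal S(2) by blast
  then show ?thesis using K(3) by blast
qed

end

section \<open>Palindromes and normal closures under homomorphisms\<close>

context group_hom
begin

lemma list_mult_hom: "set w \<subseteq> carrier G \<Longrightarrow> h (list_mult G w) = list_mult H (map h w)"
  by (induction w) auto

text \<open>To lift a palindrome, choose one preimage for each letter of the image. Equal letters
  then have equal lifts, so the lifted word is still a palindrome.\<close>

lemma palindromic_elements_image:
  assumes X: "X \<subseteq> carrier G"
  shows "palindromic_elements H (h ` X) = h ` palindromic_elements G X"
proof -
  have L: "h ` G.letters X = H.letters (h ` X)"
    using X by (force simp: image_Un image_image)
  have LX: "G.letters X \<subseteq> carrier G" using G.letters_closed[OF X] .
  show ?thesis
  proof (intro equalityI subsetI)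
    fix q assume "q \<in> palindromic_elements H (h ` X)"
    then obtain w where w: "q = list_mult H w" "set w \<subseteq> h ` G.letters X" "rev w = w"
      unfolding palindromic_elements_def palindromic_word_def L by blast
    define v where "v = map (inv_into (G.letters X) h) w"
    have "inv_into (G.letters X) h y \<in> G.letters X" "h (inv_into (G.letters X) h y) = y"
      if "y \<in> set w" for y
      using that w(2) inv_into_into[of y h "G.letters X"] f_inv_into_f[of y h "G.letters X"] by blast+
    then have v: "set v \<subseteq> G.letters X" "rev v = v" "map h v = w"
      unfolding v_def using w(3)
      by (auto simp: rev_map intro!: map_idI simp del: Un_iff)
    then have "q = h (list_mult G v)" using list_mult_hom[of v] subset_trans[OF v(1) LX] w(1) by simp
    then show "q \<in> h ` palindromic_elements G X"
      using G.palindromic_elementI[OF v(1,2)] by blast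
  next
    fix q assume "q \<in> h ` palindromic_elements G X"
    then obtain w where w: "q = h (list_mult G w)" "set w \<subseteq> G.letters X" "rev w = w"
      unfolding palindromic_elements_def palindromic_word_def by blast
    have "q = list_mult H (map h w)" using w LX list_mult_hom by blast
    moreover have "set (map h w) \<subseteq> H.letters (h ` X)"
      unfolding L[symmetric] set_map using w(2) by (rule image_mono)
    moreover have "rev (map h w) = map h w" using w(3) by (simp add: rev_map)
    ultimately show "q \<in> palindromic_elements H (h ` X)"
      using H.palindromic_elementI by metis
  qed
qed

lemma palindrome_products_image:
  assumes X: "X \<subseteq> carrier G"
  shows "palindrome_products H (h ` X) n = h ` palindrome_products G X n"
proof (intro equalityI subsetI)
  fix q assume "q \<in> palindrome_products H (h ` X) n"
  then obtain ps where ps: "q = list_mult H ps" "length ps \<le> n"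
    "set ps \<subseteq> h ` palindromic_elements G X"
    unfolding palindrome_products_def palindromic_elements_image[OF X] by blast
  have "ps \<in> map h ` lists (palindromic_elements G X)"
    using ps(3) by (simp add: lists_image[symmetric] subset_iff in_lists_conv_set)
  then obtain qs where qs: "ps = map h qs" "set qs \<subseteq> palindromic_elements G X"
    unfolding lists_eq_set by blast
  have "q = h (list_mult G qs)"
    using ps(1) qs(1) list_mult_hom[OF subset_trans[OF qs(2) G.palindromic_elements_closed[OF X]]]
    by simp
  moreover have "list_mult G qs \<in> palindrome_products G X n"
    unfolding palindrome_products_def using qs ps(2) by (intro CollectI exI[of _ qs]) simp
  ultimately show "q \<in> h ` palindrome_products G X n" by blast
next
  fix q assume "q \<in> h ` palindrome_products G X n"
  then obtain ps where ps: "q = h (list_mult G ps)" "length ps \<le> n"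
    "set ps \<subseteq> palindromic_elements G X"
    unfolding palindrome_products_def by blast
  then have "q = list_mult H (map h ps)"
    using list_mult_hom[OF subset_trans[OF ps(3) G.palindromic_elements_closed[OF X]]] by simp
  moreover have "set (map h ps) \<subseteq> h ` palindromic_elements G X"
    unfolding set_map using ps(3) by (rule image_mono)
  ultimately show "q \<in> palindrome_products H (h ` X) n"
    unfolding palindrome_products_def palindromic_elements_image[OF X]
    using ps(2) by (intro CollectI exI[of _ "map h ps"]) simp
qed

lemma normal_vimage:
  assumes "K \<lhd> H"
  shows "{g \<in> carrier G. h g \<in> K} \<lhd> G"
proof (rule G.normal_invI)
  interpret K: normal K H by fact
  show "subgroup {g \<in> carrier G. h g \<in> K} G"
    by (rule G.subgroupI) (auto intro: exI[of _ "\<one>\<^bsub>G\<^esub>"])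
  fix x g assume "x \<in> carrier G" "g \<in> {g \<in> carrier G. h g \<in> K}"
  then show "x \<otimes>\<^bsub>G\<^esub> g \<otimes>\<^bsub>G\<^esub> inv\<^bsub>G\<^esub> x \<in> {g \<in> carrier G. h g \<in> K}"
    using K.inv_op_closed2 by simp
qed

lemma normal_closure_image:
  assumes "S \<subseteq> carrier G"
  shows "h ` normal_closure G S \<subseteq> normal_closure H (h ` S)"
proof -
  have "h ` normal_closure G S \<subseteq> K" if "K \<lhd> H" "h ` S \<subseteq> K" for K
    using normal_closure_minimal[OF normal_vimage[OF that(1)], of S] assms that(2) by blast
  then show ?thesis unfolding normal_closure_def[of H] by blast
qed

lemma generate_image:
  assumes "X \<subseteq> carrier G" "generate G X = carrier G" "h ` carrier G = carrier H"
  shows "generate H (h ` X) = carrier H"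
  using generate_img[OF assms(1)] assms(2,3) by simp

end

section \<open>Descent along the derived series\<close>

context group
begin

text \<open>In the quotient by the derived subgroup of \<open>N\<close>, the image of
  \<open>N\<close> is abelian and normally generated by the image of \<open>S\<close>. So, modulo
  that derived subgroup, the factor from \<open>N\<close> can be replaced by boundedly many
  palindromes, and the two bounds add.\<close>

lemma palindrome_products_derived_step:
  assumes N: "N \<lhd> G" and S: "finite S" "normal_closure G S = N"
    and B: "finite B" "B \<subseteq> carrier G" "generate G B = carrier G"
    and n: "carrier G \<subseteq> palindrome_products G B n <#> N"
  shows "\<exists>m. carrier G \<subseteq> palindrome_products G (B \<union> S) m <#> derived G N"
proof -
  define M where "M = derived G N"
  have M: "M \<lhd> G" unfolding M_def using derived_is_normal[OF N] .
  interpret N: normal N G by fact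
  interpret M: normal M G by fact
  define Q where "Q = G Mod M"
  define h where "h = (\<lambda>g. M #> g)"
  have "group Q" unfolding Q_def using M.factorgroup_is_group .
  moreover have "h \<in> hom G Q" unfolding Q_def h_def using M.r_coset_hom_Mod .
  ultimately interpret h: group_hom G Q h
    by (intro group_hom.intro is_group group_hom_axioms.intro)
  have surj: "h ` carrier G = carrier Q" unfolding Q_def h_def carrier_FactGroup ..
  have SN: "S \<subseteq> N" using subset_normal_closure[of S G] S(2) by simp
  define X where "X = B \<union> S"
  have X: "X \<subseteq> carrier G" "finite X"
    using B(1,2) S(1) subset_trans[OF SN N.subset] unfolding X_def by simp_all
  have gen: "generate G X = carrier G"
    using mono_generate[of B X] B(3) generate_incl[OF X(1)] unfolding X_def by simp
  have comm: "a \<otimes>\<^bsub>Q\<^esub> b = b \<otimes>\<^bsub>Q\<^esub> a" if ab: "a \<in> h ` N" "b \<in> h ` N" for a b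
  proof -
    obtain x y where xy: "a = h x" "b = h y" "x \<in> N" "y \<in> N" using ab by blast
    have c: "x \<in> carrier G" "y \<in> carrier G" using xy N.mem_carrier by auto
    have "x \<otimes> y \<otimes> inv x \<otimes> inv y \<in> M"
      unfolding M_def derived_def using xy by (blast intro: generate.incl)
    then have "h (x \<otimes> y \<otimes> inv x \<otimes> inv y) = \<one>\<^bsub>Q\<^esub>"
      unfolding Q_def h_def by (simp add: coset_join2 M.subgroup_axioms)
    \<comment> \<open>Write \<open>x \<otimes> y\<close> as the commutator of \<open>x\<close> and
      \<open>y\<close> times \<open>y \<otimes> x\<close>; the first factor dies in the
      quotient.\<close>
    then have "h (x \<otimes> y \<otimes> inv x \<otimes> inv y) \<otimes>\<^bsub>Q\<^esub> h (y \<otimes> x) = h (y \<otimes> x)" using c by simp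
    moreover have "h (x \<otimes> y \<otimes> inv x \<otimes> inv y) \<otimes>\<^bsub>Q\<^esub> h (y \<otimes> x) =
      h (x \<otimes> y \<otimes> inv x \<otimes> inv y \<otimes> (y \<otimes> x))" using c by simp
    moreover have "x \<otimes> y \<otimes> inv x \<otimes> inv y \<otimes> (y \<otimes> x) = x \<otimes> y" using c by (simp add: m_assoc)
    ultimately show ?thesis using xy c by simp
  qed
  have "\<exists>m. h ` N \<subseteq> palindrome_products Q (h ` X) m"
  proof (rule h.H.abelian_normal_closure_bounded)
    show "h ` N \<lhd> Q" using N.surj_hom_normal_subgroup[OF h.group_hom_axioms surj] .
    show "h ` X \<subseteq> carrier Q" using X(1) by auto
    show "generate Q (h ` X) = carrier Q" using h.generate_image[OF X(1) gen surj] .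
    show "h ` N \<subseteq> normal_closure Q (h ` S)"
      using h.normal_closure_image[of S] SN N.subset S(2) by auto
    show "finite (h ` X)" using X(2) by simp
    show "h ` S \<subseteq> h ` X \<inter> h ` N" using SN unfolding X_def by blast
  qed (rule comm)
  then obtain m where m: "h ` N \<subseteq> h ` palindrome_products G X m"
    using h.palindrome_products_image[OF X(1)] by auto
  have "g \<in> palindrome_products G X (n + m) <#> M" if g: "g \<in> carrier G" for g
  proof -
    obtain p a where pa: "p \<in> palindrome_products G X n" "a \<in> N" "g = p \<otimes> a"
      using n g palindrome_products_mono[of n n B X G] unfolding set_mult_def X_def by blast
    obtain q where q: "q \<in> palindrome_products G X m" "h a = h q" using m pa(2) by blast
    have c: "p \<in> carrier G" "a \<in> carrier G" "q \<in> carrier G"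
      using pa q palindrome_products_closed[OF X(1)] N.mem_carrier by auto
    \<comment> \<open>\<open>h\<close> sends elements to right cosets. Normality turns the coset
      into a left one, which puts the remainder \<open>k\<close> on the right, as the goal
      demands.\<close>
    have "a \<in> q <# M"
      using q(2) rcos_self[OF c(2) M.subgroup_axioms] M.coset_eq c(3) unfolding h_def by simp
    then obtain k where k: "k \<in> M" "a = q \<otimes> k" unfolding l_coset_def by blast
    have "g = (p \<otimes> q) \<otimes> k" using pa k c by (simp add: m_assoc)
    moreover have "p \<otimes> q \<in> palindrome_products G X (n + m)"
      using palindrome_products_mult[OF X(1) pa(1) q(1)] .
    ultimately show ?thesis unfolding set_mult_def using k(1) by blast
  qed
  then show ?thesis unfolding M_def X_def by blast
qed

text \<open>\<open>B\<close> and \<open>n\<close> may depend on \<open>i\<close>: each layer adds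
  the finite set given by max-n. Earlier palindromes survive, since enlarging the alphabet keeps
  them palindromes.\<close>

lemma palindrome_products_mod_derived:
  assumes "finitely_generated G" "max_n G"
  shows "\<exists>B n. finite B \<and> generating_set G B \<and>
    carrier G \<subseteq> palindrome_products G B n <#> (derived G ^^ i) (carrier G)"
proof (induction i)
  case 0
  obtain B where B: "finite B" "generating_set G B"
    using assms(1) unfolding finitely_generated_def by blast
  \<comment> \<open>At the top of the series the second factor is the whole group, so the empty
    product is enough.\<close>
  have "carrier G \<subseteq> palindrome_products G B 0 <#> carrier G"
    using palindrome_products_one[of B 0] unfolding set_mult_def by force
  then show ?case using B by auto
next
  case (Suc i)
  then obtain B n where B: "finite B" "B \<subseteq> carrier G" "generate G B = carrier G"
    and n: "carrier G \<subseteq> palindrome_products G B n <#> (derived G ^^ i) (carrier G)"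
    unfolding generating_set_def by blast
  have N: "(derived G ^^ i) (carrier G) \<lhd> G"
    by (induction i) (simp_all add: normal_self derived_is_normal)
  then obtain S where S: "finite S" "S \<subseteq> carrier G"
    "normal_closure G S = (derived G ^^ i) (carrier G)"
    using assms(2) unfolding max_n_def by blast
  obtain m where "carrier G \<subseteq>
    palindrome_products G (B \<union> S) m <#> derived G ((derived G ^^ i) (carrier G))"
    using palindrome_products_derived_step[OF N S(1,3) B n] by blast
  moreover have "generating_set G (B \<union> S)"
    using mono_generate[of B "B \<union> S"] B S(2) generate_incl[of "B \<union> S"]
    unfolding generating_set_def by blast
  ultimately show ?case using B(1) S(1) by auto
qed

end

theorem theorem1p5:
  fixes G :: "('a, 'b) monoid_scheme"
  assumes "group G"
    and "finitely_generated G"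
    and "solvable G"
    and "max_n G"
  shows "\<exists>B. finite B \<and> generating_set G B \<and> palindromic_width G B < \<infinity>"
proof -
  interpret group G by fact
  \<comment> \<open>Once the derived series reaches the trivial subgroup, covering the group modulo
    that term means covering the group itself.\<close>
  obtain i where "(derived G ^^ i) (carrier G) = {\<one>\<^bsub>G\<^esub>}"
    using solvable_imp_trivial_derived_seq assms(3) unfolding solvable_def by blast
  then obtain B n where B: "finite B" "generating_set G B"
    and n: "carrier G \<subseteq> palindrome_products G B n <#>\<^bsub>G\<^esub> {\<one>\<^bsub>G\<^esub>}"
    using palindrome_products_mod_derived[OF assms(2,4), of i] by auto
  have "palindrome_products G B n \<subseteq> carrier G"
    using palindrome_products_closed B(2) unfolding generating_set_def by blast
  then have "carrier G \<subseteq> palindrome_products G B n"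
    using n unfolding set_mult_def by force
  then have "palindromic_width G B \<le> enat n"
    unfolding palindromic_width_def palindrome_products_def by (intro Inf_lower) blast
  then show ?thesis using B by (meson enat_ord_code(4) le_less_trans)
qed

end
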